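(* Let $m,n$ be positive integers. If $G\in G_{m,n}$, then $diam(G)\le 4$.
   Context: All graphs are finite and simple. For positive integers $m,n$, $G_{m,n}$ denotes the class of all simple graphs that have the same degree sequence as the disjoint union $K_m\cup K_n$ of two cliques (that is, $m$ vertices of degree $m-1$ and $n$ further vertices of degree $n-1$) but are not isomorphic to $K_m\cup K_n$. The diameter $diam(G)$ is the maximum over all pairs of vertices $u,v$ of the distance $d(u,v)$, the number of edges in a shortest path between $u$ and $v$. *)

theory Defs
  imports "Graph_Theory.Graph_Theory" "HOL-Library.Multiset"
begin

text \<open>
  A finite simple graph is a digraph satisfying \<^locale>\<open>graph\<close>: every undirected edge is
  represented by its two opposite arcs. Hence the degree of a vertex is its out-degree, and
  walks of length \<open>k\<close> use \<open>k\<close> edges.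
\<close>

definition complete_graph :: "nat \<Rightarrow> (nat, nat \<times> nat) pre_digraph" where
  "complete_graph n =
    \<lparr>verts = {..<n}, arcs = {(u, v). u < n \<and> v < n \<and> u \<noteq> v}, tail = fst, head = snd\<rparr>"

definition disjoint_union ::
  "('a, 'b) pre_digraph \<Rightarrow> ('c, 'd) pre_digraph \<Rightarrow> ('a + 'c, 'b + 'd) pre_digraph" where
  "disjoint_union G H =
    \<lparr>verts = verts G <+> verts H, arcs = arcs G <+> arcs H,
     tail = map_sum (tail G) (tail H), head = map_sum (head G) (head H)\<rparr>"

text \<open>The degrees of all vertices with repetitions, listed in non-increasing order.\<close>

definition degree_sequence :: "('a, 'b) pre_digraph \<Rightarrow> nat list" where
  "degree_sequence G = rev (sorted_list_of_multiset (image_mset (out_degree G) (mset_set (verts G))))"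

definition two_clique_class :: "nat \<Rightarrow> nat \<Rightarrow> ('a, 'b) pre_digraph set" where
  "two_clique_class m n =
    {G. graph G
      \<and> degree_sequence G = degree_sequence (disjoint_union (complete_graph m) (complete_graph n))
      \<and> \<not> digraph_iso G (disjoint_union (complete_graph m) (complete_graph n))}"

text \<open>
  The least cost of a walk with all arcs of cost \<open>1\<close>, i.e. the number of edges of a shortest
  path; it is \<open>\<infinity>\<close> if there is no walk from \<open>u\<close> to \<open>v\<close>.
\<close>

definition graph_dist :: "('a, 'b) pre_digraph \<Rightarrow> 'a \<Rightarrow> 'a \<Rightarrow> ereal" where
  "graph_dist G u v = wf_digraph.\<mu> G (\<lambda>_. 1) u v"

text \<open>
  For a finite nonempty graph the supremum is attained. Disconnected graphs have diameter
  \<open>\<infinity>\<close>, so a finite bound on the diameter includes connectedness.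
\<close>

definition graph_diam :: "('a, 'b) pre_digraph \<Rightarrow> ereal" where
  "graph_diam G = (SUP u\<in>verts G. SUP v\<in>verts G. graph_dist G u v)"

lemma graph_complete_graph: "graph (complete_graph n)"
proof -
  have "finite {(u, v). u < n \<and> v < n \<and> u \<noteq> v}"
    by (rule finite_subset[of _ "{..<n} \<times> {..<n}"]) auto
  then show ?thesis
    by unfold_locales (auto simp: complete_graph_def arc_to_ends_def symmetric_conv)
qed

lemma complete_digraph_complete_graph: "K\<^bsub>n\<^esub> (complete_graph n)"
  using graph_complete_graph[of n]
  by (auto simp: complete_digraph_def complete_graph_def arcs_ends_conv)

lemma graph_disjoint_union:
  assumes "graph G" "graph H"
  shows "graph (disjoint_union G H)"
proof -
  interpret G: graph G by fact
  interpret H: graph H by fact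
  have "symmetric G" "symmetric H"
    by (rule G.sym_arcs, rule H.sym_arcs)
  then have "symmetric (disjoint_union G H)"
    unfolding symmetric_conv disjoint_union_def by (simp add: ball_Un bex_Un Plus_def)
  then show ?thesis
    by unfold_locales
      (auto simp: disjoint_union_def arc_to_ends_def
        dest: G.no_loops H.no_loops intro: G.no_multi_arcs H.no_multi_arcs)
qed

lemma out_degree_disjoint_union:
  "out_degree (disjoint_union G H) (Inl u) = out_degree G u"
  "out_degree (disjoint_union G H) (Inr v) = out_degree H v"
proof -
  have "out_arcs (disjoint_union G H) (Inl u) = Inl ` out_arcs G u"
    "out_arcs (disjoint_union G H) (Inr v) = Inr ` out_arcs H v"
    by (auto simp: out_arcs_def disjoint_union_def elim: PlusE)
  then show "out_degree (disjoint_union G H) (Inl u) = out_degree G u"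
    "out_degree (disjoint_union G H) (Inr v) = out_degree H v"
    by (simp_all add: out_degree_def card_image)
qed

lemma out_degree_complete_graph:
  assumes "u < n"
  shows "out_degree (complete_graph n) u = n - 1"
proof -
  have "out_arcs (complete_graph n) u = Pair u ` ({..<n} - {u})"
    using assms by (auto simp: out_arcs_def complete_graph_def)
  then show ?thesis
    using assms by (simp add: out_degree_def card_image inj_on_def)
qed

end

theory Submission
  imports Defs
begin

text \<open>
  Write \<open>N[u]\<close> for the closed neighbourhood of \<open>u\<close>, so that \<open>N[u]\<close> has one element more than the
  degree of \<open>u\<close>. The key case is a vertex \<open>u\<close> of degree \<open>m - 1\<close> and a vertex \<open>v\<close> of degree
  \<open>n - 1\<close>. If \<open>N[u]\<close> and \<open>N[v]\<close> share a vertex or are joined by an edge, then \<open>u\<close> and \<open>v\<close> have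
  distance at most \<open>3\<close>. Otherwise these two sets, of \<open>m\<close> and \<open>n\<close> elements, partition the \<open>m + n\<close>
  vertices with no edge between the parts. Every vertex then has its closed neighbourhood inside its
  own part, so the sum of the sizes \<open>|N[w]|\<close> is at most \<open>m\<^sup>2 + n\<^sup>2\<close>. The degree sequence makes this
  an equality, hence both parts are cliques and the graph is \<open>K\<^sub>m \<union> K\<^sub>n\<close>, which is excluded
  (\<open>within_three_if_complementary_degrees\<close>).

  Now let \<open>u\<close> and \<open>v\<close> have the same degree, say \<open>m - 1\<close>. For \<open>m = n\<close> the key case applies to them.
  For \<open>m \<noteq> n\<close>, either \<open>v\<close> has a neighbour \<open>w\<close> of degree \<open>n - 1\<close>, which is within \<open>3\<close> of \<open>u\<close>, and
  one more edge gives \<open>4\<close>; or \<open>N[v]\<close> consists of vertices of degree \<open>m - 1\<close> only. There are exactly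
  \<open>m\<close> of those, as many as \<open>N[v]\<close> has elements, so \<open>N[v]\<close> contains \<open>u\<close>
  (\<open>within_four_if_same_degree\<close>).
\<close>

section \<open>Isomorphisms from vertex bijections\<close>

text \<open>
  Without parallel arcs an arc is determined by its ends, so a vertex bijection that respects
  adjacency induces the bijection of arcs that an isomorphism has to supply.
\<close>

lemma digraph_iso_if_dominates_iff:
  assumes "nomulti_digraph G" "nomulti_digraph H"
    and f: "bij_betw f (verts G) (verts H)"
    and adj: "\<And>u v. \<lbrakk>u \<in> verts G; v \<in> verts G\<rbrakk> \<Longrightarrow> u \<rightarrow>\<^bsub>G\<^esub> v \<longleftrightarrow> f u \<rightarrow>\<^bsub>H\<^esub> f v"
  shows "digraph_iso G H"
proof -
  interpret G: nomulti_digraph G by fact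
  interpret H: nomulti_digraph H by fact
  have inj: "inj_on f (verts G)" and surj: "f ` verts G = verts H"
    using f by (auto simp: bij_betw_def)
  define ends where "ends a = (f (tail G a), f (head G a))" for a
  define g where "g a = the_inv_into (arcs H) (arc_to_ends H) (ends a)" for a
  have ends: "ends a \<in> arc_to_ends H ` arcs H" if "a \<in> arcs G" for a
    unfolding arcs_ends_def[symmetric] ends_def
    using that adj[of "tail G a" "head G a"] G.dominatesI[of a] by (simp add: arc_to_ends_def)
  have g: "g a \<in> arcs H" "arc_to_ends H (g a) = ends a" if "a \<in> arcs G" for a
    unfolding g_def using ends[OF that] H.inj_on_arc_to_ends
    by (auto intro: the_inv_into_into f_the_inv_into_f)
  have inj_ends: "a = b" if "a \<in> arcs G" "b \<in> arcs G" "ends a = ends b" for a b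
    using that inj by (intro G.no_multi_arcs) (auto simp: ends_def arc_to_ends_def dest: inj_onD)
  have g_inj: "inj_on g (arcs G)"
    by (rule inj_onI) (metis g(2) inj_ends)
  have "b \<in> g ` arcs G" if b: "b \<in> arcs H" for b
  proof -
    obtain u v where uv: "u \<in> verts G" "v \<in> verts G" "tail H b = f u" "head H b = f v"
      using H.tail_in_verts[OF b] H.head_in_verts[OF b] surj by (metis imageE)
    then have "u \<rightarrow>\<^bsub>G\<^esub> v"
      using adj b by (metis H.dominatesI arc_to_ends_def)
    then obtain a where a: "a \<in> arcs G" "tail G a = u" "head G a = v" by auto
    then have "g a = b"
      using g[OF a(1)] b uv by (intro H.no_multi_arcs) (auto simp: ends_def arc_to_ends_def)
    with a show ?thesis by blast
  qed
  then have g_surj: "g ` arcs G = arcs H" using g by auto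
  \<comment> \<open>The image under an isomorphism takes its end maps verbatim from the isomorphism. Using those
    of \<open>H\<close> makes the image equal to \<open>H\<close> as a record, also outside the arcs.\<close>
  define hom where
    "hom = \<lparr>iso_verts = f, iso_arcs = g, iso_head = head H, iso_tail = tail H\<rparr>"
  have "G.digraph_isomorphism hom"
    unfolding G.digraph_isomorphism_def
    using inj g_inj g(2) G.wf_digraph by (auto simp: hom_def ends_def arc_to_ends_def)
  moreover have "H = app_iso hom G"
    by (simp add: app_iso_def hom_def surj g_surj)
  ultimately show ?thesis by (auto simp: digraph_iso_def)
qed

section \<open>Neighbourhoods and distances\<close>

definition closed_neighbourhood :: "('a, 'b) pre_digraph \<Rightarrow> 'a \<Rightarrow> 'a set" where
  "closed_neighbourhood G u = insert u {v. u \<rightarrow>\<^bsub>G\<^esub> v}"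

lemma (in digraph) closed_neighbourhood_subset:
  "u \<in> verts G \<Longrightarrow> closed_neighbourhood G u \<subseteq> verts G"
  by (auto simp: closed_neighbourhood_def)

lemma (in digraph) finite_closed_neighbourhood: "finite (closed_neighbourhood G u)"
  by (rule finite_subset[of _ "insert u (verts G)"])
    (auto simp: closed_neighbourhood_def)

lemma (in digraph) card_closed_neighbourhood:
  "card (closed_neighbourhood G u) = Suc (out_degree G u)"
proof -
  have "{v. u \<rightarrow>\<^bsub>G\<^esub> v} = head G ` out_arcs G u"
    by (auto simp: arcs_ends_conv)
  moreover have "inj_on (head G) (out_arcs G u)"
    by (rule inj_onI) (auto intro: no_multi_arcs simp: arc_to_ends_def)
  ultimately have "card {v. u \<rightarrow>\<^bsub>G\<^esub> v} = out_degree G u"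
    by (simp add: out_degree_def card_image)
  moreover have "u \<notin> {v. u \<rightarrow>\<^bsub>G\<^esub> v}" by (auto dest: adj_not_same)
  moreover have "finite {v. u \<rightarrow>\<^bsub>G\<^esub> v}"
    using finite_closed_neighbourhood by (simp add: closed_neighbourhood_def)
  ultimately show ?thesis by (simp add: closed_neighbourhood_def)
qed

lemma (in graph) dominates_sym: "u \<rightarrow>\<^bsub>G\<^esub> v \<Longrightarrow> v \<rightarrow>\<^bsub>G\<^esub> u"
  using arcs_ends_symmetric[OF sym_arcs] .

text \<open>
  Being joined by a walk with at most \<open>k\<close> edges is expressed by the \<open>k\<close>-th power of the reflexive
  closure of adjacency: the idle steps absorb all cases of coinciding vertices.
\<close>

lemma relpow_reflcl_mono:
  assumes "j \<le> k"
  shows "(R\<^sup>=) ^^ j \<subseteq> (R\<^sup>=) ^^ k"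
  using assms by (induction rule: dec_induct) auto

lemma (in wf_digraph) ex_awalk_if_relpow_reflcl:
  assumes "(u, v) \<in> ((arcs_ends G)\<^sup>=) ^^ k" "u \<in> verts G"
  shows "\<exists>p. awalk u p v \<and> length p \<le> k"
  using assms
proof (induction k arbitrary: u)
  case 0
  then show ?case by (auto simp: awalk_Nil_iff)
next
  case (Suc k)
  then obtain w where w: "u = w \<or> u \<rightarrow>\<^bsub>G\<^esub> w" "(w, v) \<in> ((arcs_ends G)\<^sup>=) ^^ k"
    by (blast dest: relpow_Suc_D2)
  with Suc obtain p where p: "awalk w p v" "length p \<le> k"
    by (blast dest: adj_in_verts)
  from w(1) show ?case
  proof
    assume "u = w"
    with p show ?case by (auto intro: le_SucI)
  next
    assume "u \<rightarrow>\<^bsub>G\<^esub> w"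
    then obtain e where "e \<in> arcs G" "tail G e = u" "head G e = w" by auto
    with p have "awalk u (e # p) v" by (simp add: awalk_Cons_iff)
    with p(2) show ?case by (intro exI[of _ "e # p"]) simp
  qed
qed

lemma (in wf_digraph) graph_dist_le_if_relpow_reflcl:
  assumes "(u, v) \<in> ((arcs_ends G)\<^sup>=) ^^ k" "u \<in> verts G"
  shows "graph_dist G u v \<le> ereal (real k)"
proof -
  obtain p where p: "awalk u p v" "length p \<le> k"
    using ex_awalk_if_relpow_reflcl[OF assms] by auto
  have "awalk_cost (\<lambda>_. 1) p = real (length p)"
    by (simp add: awalk_cost_def sum_list_triv)
  with min_cost_le_walk_cost[OF p(1), of "\<lambda>_. 1"]
  have "graph_dist G u v \<le> ereal (real (length p))"
    by (simp add: graph_dist_def)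
  also have "\<dots> \<le> ereal (real k)" using p(2) by simp
  finally show ?thesis .
qed

lemma (in graph) relpow_three_if_closed_neighbourhoods_touch:
  assumes "x \<in> closed_neighbourhood G u" "y \<in> closed_neighbourhood G v" "x = y \<or> x \<rightarrow>\<^bsub>G\<^esub> y"
  shows "(u, v) \<in> ((arcs_ends G)\<^sup>=) ^^ 3"
proof -
  have "(u, x) \<in> (arcs_ends G)\<^sup>=" "(x, y) \<in> (arcs_ends G)\<^sup>=" "(y, v) \<in> (arcs_ends G)\<^sup>="
    using assms by (auto simp: closed_neighbourhood_def intro: dominates_sym)
  then show ?thesis
    by (auto simp: numeral_3_eq_3 simp del: Un_iff)
qed

section \<open>Degree sequences of two cliques\<close>

text \<open>Sorting keeps the multiset of degrees, and the multiset is what all counting below uses.\<close>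

lemma degree_sequence_eqD:
  assumes "degree_sequence G = degree_sequence H"
  shows "image_mset (out_degree G) (mset_set (verts G)) =
    image_mset (out_degree H) (mset_set (verts H))"
  using arg_cong[OF assms, of mset] by (simp add: degree_sequence_def)

abbreviation two_cliques :: "nat \<Rightarrow> nat \<Rightarrow> (nat + nat, nat \<times> nat + nat \<times> nat) pre_digraph" where
  "two_cliques m n \<equiv> disjoint_union (complete_graph m) (complete_graph n)"

lemma degrees_two_cliques:
  "image_mset (out_degree (two_cliques m n)) (mset_set (verts (two_cliques m n))) =
    replicate_mset m (m - 1) + replicate_mset n (n - 1)"
proof -
  let ?H = "two_cliques m n"
  have V: "verts ?H = Inl ` {..<m} \<union> Inr ` {..<n}"
    by (auto simp: disjoint_union_def complete_graph_def)
  have "mset_set (verts ?H) = image_mset Inl (mset_set {..<m}) + image_mset Inr (mset_set {..<n})"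
    unfolding V by (subst mset_set_Union) (auto simp: image_mset_mset_set)
  moreover have "image_mset (\<lambda>x. out_degree ?H (Inl x)) (mset_set {..<m}) =
      image_mset (\<lambda>_. m - 1) (mset_set {..<m})"
    by (rule image_mset_cong) (simp add: out_degree_disjoint_union out_degree_complete_graph)
  moreover have "image_mset (\<lambda>x. out_degree ?H (Inr x)) (mset_set {..<n}) =
      image_mset (\<lambda>_. n - 1) (mset_set {..<n})"
    by (rule image_mset_cong) (simp add: out_degree_disjoint_union out_degree_complete_graph)
  ultimately show ?thesis
    by (simp add: image_mset.compositionality comp_def image_mset_const_eq)
qed

lemma arcs_ends_disjoint_union:
  "arcs_ends (disjoint_union G H) =
    map_prod Inl Inl ` arcs_ends G \<union> map_prod Inr Inr ` arcs_ends H"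
  by (simp add: arcs_ends_conv disjoint_union_def Plus_def image_Un image_image)

lemma arcs_ends_complete_graph:
  "arcs_ends (complete_graph n) = {(u, v). u < n \<and> v < n \<and> u \<noteq> v}"
  by (simp add: arcs_ends_conv complete_graph_def)

text \<open>
  Numbering the two parts separately gives the isomorphism, since on both sides two distinct
  vertices are adjacent exactly if they lie in the same part.
\<close>

lemma digraph_iso_two_cliquesI:
  assumes "graph G" and V: "verts G = X \<union> Y" "X \<inter> Y = {}" and card: "card X = m" "card Y = n"
    and X: "\<And>x. x \<in> X \<Longrightarrow> closed_neighbourhood G x = X"
    and Y: "\<And>y. y \<in> Y \<Longrightarrow> closed_neighbourhood G y = Y"
  shows "digraph_iso G (two_cliques m n)"
proof -
  interpret graph G by fact
  interpret H: graph "two_cliques m n"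
    by (intro graph_disjoint_union graph_complete_graph)
  have fin: "finite X" "finite Y" using V(1) finite_verts by auto
  obtain f where f: "bij_betw f X {..<m}"
    using ex_bij_betw_finite_nat[OF fin(1)] card(1) by (auto simp: atLeast0LessThan)
  obtain g where g: "bij_betw g Y {..<n}"
    using ex_bij_betw_finite_nat[OF fin(2)] card(2) by (auto simp: atLeast0LessThan)
  define h where "h v = (if v \<in> X then Inl (f v) else Inr (g v))" for v
  have "bij_betw h X (Inl ` {..<m})"
    using f by (auto simp: h_def bij_betw_def inj_on_def image_iff)
  moreover have "bij_betw h Y (Inr ` {..<n})"
  proof -
    have "bij_betw (Inr \<circ> g) Y (Inr ` {..<n})"
      using g by (auto simp: bij_betw_def inj_on_def image_comp[symmetric])
    then show ?thesis
      using V(2) by (subst bij_betw_cong[of Y h "Inr \<circ> g"]) (auto simp: h_def)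
  qed
  ultimately have "bij_betw h (X \<union> Y) (Inl ` {..<m} \<union> Inr ` {..<n})"
    by (rule bij_betw_combine) auto
  then have h: "bij_betw h (verts G) (verts (two_cliques m n))"
    by (simp add: V(1) disjoint_union_def complete_graph_def Plus_def)
  have adjG: "u \<rightarrow>\<^bsub>G\<^esub> v \<longleftrightarrow> u \<noteq> v \<and> (u \<in> X \<longleftrightarrow> v \<in> X)"
    if "u \<in> verts G" "v \<in> verts G" for u v
  proof -
    have "u \<rightarrow>\<^bsub>G\<^esub> v \<longleftrightarrow> u \<noteq> v \<and> v \<in> closed_neighbourhood G u"
      by (auto simp: closed_neighbourhood_def dest: adj_not_same)
    then show ?thesis using that V X Y by auto
  qed
  have adjH: "a \<rightarrow>\<^bsub>two_cliques m n\<^esub> b \<longleftrightarrow> a \<noteq> b \<and> (isl a \<longleftrightarrow> isl b)"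
    if "a \<in> verts (two_cliques m n)" "b \<in> verts (two_cliques m n)" for a b
    using that
    by (auto simp: arcs_ends_disjoint_union arcs_ends_complete_graph)
      (auto simp: disjoint_union_def complete_graph_def)
  show ?thesis
  proof (rule digraph_iso_if_dominates_iff[OF _ _ h])
    show "nomulti_digraph G" "nomulti_digraph (two_cliques m n)" by unfold_locales
  next
    fix u v assume uv: "u \<in> verts G" "v \<in> verts G"
    then have "h u \<in> verts (two_cliques m n)" "h v \<in> verts (two_cliques m n)"
      using h by (auto dest: bij_betwE)
    moreover have "h u = h v \<longleftrightarrow> u = v"
      using h uv by (auto simp: bij_betw_def dest: inj_onD)
    ultimately show "u \<rightarrow>\<^bsub>G\<^esub> v \<longleftrightarrow> h u \<rightarrow>\<^bsub>two_cliques m n\<^esub> h v"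
      using uv by (simp add: adjG adjH) (simp add: h_def)
  qed
qed

section \<open>Distances in graphs with the degrees of two cliques\<close>

locale two_clique_degrees = graph +
  fixes m n :: nat
  assumes pos: "m > 0" "n > 0"
    and degrees: "image_mset (out_degree G) (mset_set (verts G)) =
      replicate_mset m (m - 1) + replicate_mset n (n - 1)"
begin

lemma card_verts: "card (verts G) = m + n"
  using arg_cong[OF degrees, of size] by simp

lemma out_degree_cases: "v \<in> verts G \<Longrightarrow> out_degree G v = m - 1 \<or> out_degree G v = n - 1"
  using arg_cong[OF degrees, of set_mset] by (auto simp: set_mset_replicate_mset_subset split: if_splits)

text \<open>
  The degree sum in the form used for the rigidity argument: a partition into parts of sizes \<open>m\<close>
  and \<open>n\<close> has the same value for the sum of the size of the own part over all vertices.
\<close>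

lemma sum_card_closed_neighbourhood:
  "(\<Sum>v\<in>verts G. card (closed_neighbourhood G v)) = m * m + n * n"
proof -
  have "(\<Sum>v\<in>verts G. out_degree G v) = m * (m - 1) + n * (n - 1)"
    using arg_cong[OF degrees, of sum_mset] by (simp add: sum_unfold_sum_mset)
  then have "(\<Sum>v\<in>verts G. card (closed_neighbourhood G v)) = m * (m - 1) + n * (n - 1) + (m + n)"
    by (simp add: card_closed_neighbourhood sum.distrib sum_Suc card_verts)
  then show ?thesis using pos by (cases m; cases n) auto
qed

text \<open>
  The numbers \<open>k\<close> and \<open>l\<close> below stand for \<open>m\<close> and \<open>n\<close> in either order, which saves the symmetric
  versions of the lemmas.
\<close>

lemma card_degree_class:
  assumes "{k, l} = {m, n}" "k \<noteq> l"
  shows "card {v \<in> verts G. out_degree G v = k - 1} = k"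
proof -
  let ?V = "{v \<in> verts G. out_degree G v = k - 1}"
  have "?V = out_degree G -` {k - 1} \<inter> verts G" by auto
  then have "card ?V = count (image_mset (out_degree G) (mset_set (verts G))) (k - 1)"
    by (simp add: count_image_mset)
  also have "\<dots> = count (replicate_mset k (k - 1) + replicate_mset l (l - 1)) (k - 1)"
    using assms(1) unfolding degrees doubleton_eq_iff by (elim disjE conjE) simp_all
  also have "\<dots> = k"
  proof -
    \<comment> \<open>Positivity matters: truncated subtraction would identify \<open>0 - 1\<close> and \<open>1 - 1\<close>.\<close>
    have "l - 1 \<noteq> k - 1"
      using assms pos unfolding doubleton_eq_iff by linarith
    then show ?thesis by simp
  qed
  finally show ?thesis .
qed

text \<open>
  If the distance exceeds \<open>3\<close>, the two closed neighbourhoods partition the vertices without an edge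
  between them. This bounds each \<open>N[w]\<close> by the part of \<open>w\<close>; the degree sum leaves no slack in any of
  these bounds, so the parts are cliques.
\<close>

lemma within_three_if_complementary_degrees:
  assumes uv: "u \<in> verts G" "v \<in> verts G"
    and kl: "{k, l} = {m, n}"
    and deg: "out_degree G u = k - 1" "out_degree G v = l - 1"
    and not_iso: "\<not> digraph_iso G (two_cliques m n)"
  shows "(u, v) \<in> ((arcs_ends G)\<^sup>=) ^^ 3"
proof (rule ccontr)
  let ?X = "closed_neighbourhood G u" and ?Y = "closed_neighbourhood G v"
  assume "(u, v) \<notin> ((arcs_ends G)\<^sup>=) ^^ 3"
  then have sep: "x \<noteq> y \<and> \<not> x \<rightarrow>\<^bsub>G\<^esub> y" if "x \<in> ?X" "y \<in> ?Y" for x y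
    using that relpow_three_if_closed_neighbourhoods_touch by blast
  then have disj: "?X \<inter> ?Y = {}" by blast
  have pos_kl: "k > 0" "l > 0" using kl pos by (auto simp: doubleton_eq_iff)
  have card: "card ?X = k" "card ?Y = l"
    using pos_kl deg by (auto simp: card_closed_neighbourhood)
  have card_kl: "card (verts G) = k + l"
    and sum_kl: "(\<Sum>w\<in>verts G. card (closed_neighbourhood G w)) = k * k + l * l"
    using kl card_verts sum_card_closed_neighbourhood by (auto simp: doubleton_eq_iff)
  have "card (?X \<union> ?Y) = card (verts G)"
    using disj card by (simp add: card_Un_disjoint finite_closed_neighbourhood card_kl)
  then have V: "verts G = ?X \<union> ?Y"
    using uv by (intro card_subset_eq[symmetric]) (auto dest: closed_neighbourhood_subset)
  define C where "C w = (if w \<in> ?X then ?X else ?Y)" for w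
  have sub: "closed_neighbourhood G w \<subseteq> C w" if "w \<in> verts G" for w
  proof
    fix x assume "x \<in> closed_neighbourhood G w"
    then have x: "x = w \<or> w \<rightarrow>\<^bsub>G\<^esub> x" "x \<in> ?X \<union> ?Y"
      using that V by (auto simp: closed_neighbourhood_def[of G w] dest: adj_in_verts)
    have "w \<in> ?X \<union> ?Y" using that V by simp
    then show "x \<in> C w"
      using x sep[of w x] sep[of x w] by (auto simp only: C_def split: if_splits dest: dominates_sym)
  qed
  have fin: "finite (C w)" for w by (simp add: C_def finite_closed_neighbourhood)
  have "(\<Sum>w\<in>verts G. card (C w)) = (\<Sum>w\<in>?X. card (C w)) + (\<Sum>w\<in>?Y. card (C w))"
    unfolding V by (rule sum.union_disjoint) (simp_all add: disj finite_closed_neighbourhood)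
  also have "\<dots> = (\<Sum>w\<in>?X. k) + (\<Sum>w\<in>?Y. l)"
    using disj card by (intro arg_cong2[of _ _ _ _ "(+)"] sum.cong) (auto simp: C_def)
  finally have "(\<Sum>w\<in>verts G. card (closed_neighbourhood G w)) = (\<Sum>w\<in>verts G. card (C w))"
    by (simp add: sum_kl card)
  then have "card (closed_neighbourhood G w) = card (C w)" if "w \<in> verts G" for w
    by (rule sum_mono_inv) (use that in \<open>auto intro!: card_mono[OF fin] sub\<close>)
  then have eq: "closed_neighbourhood G w = C w" if "w \<in> verts G" for w
    using that by (intro card_subset_eq fin sub)
  have X: "closed_neighbourhood G x = ?X" if "x \<in> ?X" for x
    using eq[of x] that V by (simp add: C_def)
  have Y: "closed_neighbourhood G y = ?Y" if "y \<in> ?Y" for y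
  proof -
    have "y \<notin> ?X" using that disj by blast
    then show ?thesis using eq[of y] that V by (simp add: C_def)
  qed
  have "digraph_iso G (two_cliques k l)"
    by (rule digraph_iso_two_cliquesI[OF graph_axioms V disj card X Y])
  moreover have "digraph_iso G (two_cliques l k)"
    by (rule digraph_iso_two_cliquesI[OF graph_axioms _ _ card(2,1) Y X])
      (simp_all only: V disj Un_commute Int_commute)
  ultimately show False using not_iso kl by (auto simp: doubleton_eq_iff)
qed

text \<open>
  For \<open>k = l\<close> the previous lemma applies to \<open>u\<close> and \<open>v\<close> themselves. For \<open>k \<noteq> l\<close>, a vertex \<open>v\<close> with a
  neighbour of degree \<open>l - 1\<close> reaches \<open>u\<close> through it. Without such a neighbour, \<open>N[v]\<close> fills the
  set of all vertices of degree \<open>k - 1\<close> by cardinality and so contains \<open>u\<close>.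
\<close>

lemma within_four_if_same_degree:
  assumes uv: "u \<in> verts G" "v \<in> verts G"
    and kl: "{k, l} = {m, n}"
    and deg: "out_degree G u = k - 1" "out_degree G v = k - 1"
    and not_iso: "\<not> digraph_iso G (two_cliques m n)"
  shows "(u, v) \<in> ((arcs_ends G)\<^sup>=) ^^ 4"
proof (cases "k = l")
  case True
  with within_three_if_complementary_degrees[OF uv kl _ _ not_iso] deg
  have "(u, v) \<in> ((arcs_ends G)\<^sup>=) ^^ 3" by simp
  then show ?thesis using relpow_reflcl_mono[of 3 4] by auto
next
  case ne: False
  show ?thesis
  proof (cases "\<exists>w. v \<rightarrow>\<^bsub>G\<^esub> w \<and> out_degree G w = l - 1")
    case True
    then obtain w where w: "v \<rightarrow>\<^bsub>G\<^esub> w" "out_degree G w = l - 1" by blast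
    have "(u, w) \<in> ((arcs_ends G)\<^sup>=) ^^ 3"
      using w uv deg kl not_iso by (intro within_three_if_complementary_degrees) (auto dest: adj_in_verts)
    moreover have "(w, v) \<in> (arcs_ends G)\<^sup>=" using w by (auto dest: dominates_sym)
    ultimately have "(u, v) \<in> ((arcs_ends G)\<^sup>=) ^^ Suc 3" by (rule relpow_Suc_I)
    then show ?thesis by simp
  next
    case False
    let ?A = "{w \<in> verts G. out_degree G w = k - 1}"
    have "out_degree G w = k - 1 \<or> out_degree G w = l - 1" if "w \<in> verts G" for w
      using out_degree_cases[OF that] kl by (auto simp: doubleton_eq_iff)
    then have "closed_neighbourhood G v \<subseteq> ?A"
      using False uv deg by (auto simp: closed_neighbourhood_def dest: adj_in_verts)
    moreover have "card (closed_neighbourhood G v) = card ?A"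
      using deg pos kl card_degree_class[OF kl ne]
      by (auto simp: card_closed_neighbourhood doubleton_eq_iff)
    ultimately have "closed_neighbourhood G v = ?A" by (intro card_subset_eq) auto
    then have "u \<in> closed_neighbourhood G v" using uv deg by simp
    then have "(u, v) \<in> ((arcs_ends G)\<^sup>=) ^^ 1"
      by (auto simp: closed_neighbourhood_def dest: dominates_sym)
    then show ?thesis using relpow_reflcl_mono[of 1 4] by auto
  qed
qed

lemma within_four:
  assumes uv: "u \<in> verts G" "v \<in> verts G" and not_iso: "\<not> digraph_iso G (two_cliques m n)"
  shows "(u, v) \<in> ((arcs_ends G)\<^sup>=) ^^ 4"
proof -
  obtain k l where kl: "{k, l} = {m, n}" and u: "out_degree G u = k - 1"
    using out_degree_cases[OF uv(1)] that[of m n] that[of n m] insert_commute[of m n "{}"] by argo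
  have "out_degree G v = k - 1 \<or> out_degree G v = l - 1"
    using out_degree_cases[OF uv(2)] kl by (auto simp: doubleton_eq_iff)
  then show ?thesis
  proof
    assume "out_degree G v = k - 1"
    then show ?thesis by (rule within_four_if_same_degree[OF uv kl u _ not_iso])
  next
    assume "out_degree G v = l - 1"
    then have "(u, v) \<in> ((arcs_ends G)\<^sup>=) ^^ 3"
      by (rule within_three_if_complementary_degrees[OF uv kl u _ not_iso])
    then show ?thesis using relpow_reflcl_mono[of 3 4] by auto
  qed
qed

end

theorem proposition10:
  fixes m n :: nat and G :: "('a, 'b) pre_digraph"
  assumes "m > 0" and "n > 0"
    and "G \<in> two_clique_class m n"
  shows "graph_diam G \<le> 4"
proof -
  let ?H = "two_cliques m n"
  from assms(3) have "graph G" and not_iso: "\<not> digraph_iso G ?H"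
    and "degree_sequence G = degree_sequence ?H"
    by (simp_all add: two_clique_class_def)
  then interpret two_clique_degrees G m n
    using assms(1,2)
    by (intro two_clique_degrees.intro two_clique_degrees_axioms.intro)
      (simp_all add: degree_sequence_eqD degrees_two_cliques)
  have "graph_dist G u v \<le> 4" if "u \<in> verts G" "v \<in> verts G" for u v
    using graph_dist_le_if_relpow_reflcl[OF within_four[OF that not_iso] that(1)] by simp
  then show ?thesis
    unfolding graph_diam_def by (intro SUP_least)
qed

end
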